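(* Let $R$ be a ring. If $R$ is left quasi-duo (respectively, right quasi-duo), then $R$ is NJ-reflexive. Conversely, if $R$ is a left SF-ring (respectively, right SF-ring) and $R$ is NJ-reflexive, then $R$ is left quasi-duo (respectively, right quasi-duo).
   Context: All rings are associative with unity and all modules are unital. $N(R)$ denotes the set of nilpotent elements of $R$ and $J(R)$ the Jacobson radical of $R$. A ring $R$ is NJ-reflexive if for all $x,y\in R$, $xRy\subseteq N(R)$ implies $yRx\subseteq J(R)$. A ring $R$ is left (right) quasi-duo if every maximal left (right) ideal of $R$ is a two-sided ideal of $R$. A ring $R$ is left (right) SF if every simple left (right) $R$-module is flat. *)

theory Defs
  imports "HOL-Algebra.Algebra" "HOL-Algebra.Free_Abelian_Groups"
begin

section \<open>One-sided ideals, nilpotent elements and the Jacobson radical\<close>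

locale left_ideal = additive_subgroup I R + ring R for I and R (structure) +
  assumes left_closed: "\<lbrakk>a \<in> I; x \<in> carrier R\<rbrakk> \<Longrightarrow> x \<otimes> a \<in> I"

locale right_ideal = additive_subgroup I R + ring R for I and R (structure) +
  assumes right_closed: "\<lbrakk>a \<in> I; x \<in> carrier R\<rbrakk> \<Longrightarrow> a \<otimes> x \<in> I"

locale maximal_left_ideal = left_ideal +
  assumes proper: "I \<noteq> carrier R"
    and maximal: "\<lbrakk>left_ideal J R; I \<subseteq> J\<rbrakk> \<Longrightarrow> J = I \<or> J = carrier R"

locale maximal_right_ideal = right_ideal +
  assumes proper: "I \<noteq> carrier R"
    and maximal: "\<lbrakk>right_ideal J R; I \<subseteq> J\<rbrakk> \<Longrightarrow> J = I \<or> J = carrier R"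

definition nilpotents :: "('a, 'b) ring_scheme \<Rightarrow> 'a set" where
  "nilpotents R = {x \<in> carrier R. \<exists>n::nat. x [^]\<^bsub>R\<^esub> n = \<zero>\<^bsub>R\<^esub>}"

text \<open>The intersection with the carrier only matters for the zero ring, which has no maximal
  left ideals and is its own radical.\<close>

definition jacobson_radical :: "('a, 'b) ring_scheme \<Rightarrow> 'a set" where
  "jacobson_radical R = carrier R \<inter> \<Inter> {I. maximal_left_ideal I R}"

definition NJ_reflexive :: "('a, 'b) ring_scheme \<Rightarrow> bool" where
  "NJ_reflexive R \<longleftrightarrow>
     (\<forall>x\<in>carrier R. \<forall>y\<in>carrier R.
        {x \<otimes>\<^bsub>R\<^esub> r \<otimes>\<^bsub>R\<^esub> y | r. r \<in> carrier R} \<subseteq> nilpotents R \<longrightarrow>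
        {y \<otimes>\<^bsub>R\<^esub> r \<otimes>\<^bsub>R\<^esub> x | r. r \<in> carrier R} \<subseteq> jacobson_radical R)"

definition left_quasi_duo :: "('a, 'b) ring_scheme \<Rightarrow> bool" where
  "left_quasi_duo R \<longleftrightarrow> (\<forall>I. maximal_left_ideal I R \<longrightarrow> ideal I R)"

definition right_quasi_duo :: "('a, 'b) ring_scheme \<Rightarrow> bool" where
  "right_quasi_duo R \<longleftrightarrow> (\<forall>I. maximal_right_ideal I R \<longrightarrow> ideal I R)"


section \<open>Modules over a noncommutative ring\<close>

text \<open>The library locale \<open>module\<close> assumes a commutative ring. Its record type is reused here
  for left and for right modules; of the inherited ring operations only the additive ones are
  relevant.\<close>

locale left_module = R?: ring R + M?: abelian_group M
  for R :: "('a, 'b) ring_scheme" (structure) and M :: "('a, 'm) module" (structure) +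
  assumes smult_closed:
      "\<lbrakk>a \<in> carrier R; x \<in> carrier M\<rbrakk> \<Longrightarrow> a \<odot>\<^bsub>M\<^esub> x \<in> carrier M"
    and smult_l_distr:
      "\<lbrakk>a \<in> carrier R; b \<in> carrier R; x \<in> carrier M\<rbrakk> \<Longrightarrow>
       (a \<oplus> b) \<odot>\<^bsub>M\<^esub> x = a \<odot>\<^bsub>M\<^esub> x \<oplus>\<^bsub>M\<^esub> b \<odot>\<^bsub>M\<^esub> x"
    and smult_r_distr:
      "\<lbrakk>a \<in> carrier R; x \<in> carrier M; y \<in> carrier M\<rbrakk> \<Longrightarrow>
       a \<odot>\<^bsub>M\<^esub> (x \<oplus>\<^bsub>M\<^esub> y) = a \<odot>\<^bsub>M\<^esub> x \<oplus>\<^bsub>M\<^esub> a \<odot>\<^bsub>M\<^esub> y"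
    and smult_assoc:
      "\<lbrakk>a \<in> carrier R; b \<in> carrier R; x \<in> carrier M\<rbrakk> \<Longrightarrow>
       (a \<otimes> b) \<odot>\<^bsub>M\<^esub> x = a \<odot>\<^bsub>M\<^esub> (b \<odot>\<^bsub>M\<^esub> x)"
    and smult_one: "x \<in> carrier M \<Longrightarrow> \<one> \<odot>\<^bsub>M\<^esub> x = x"

text \<open>In a right module, \<open>a \<odot>\<^bsub>M\<^esub> x\<close> stands for the product that is usually written
  \<open>x a\<close>; hence the order of the ring elements in \<open>smult_assoc\<close>.\<close>

locale right_module = R?: ring R + M?: abelian_group M
  for R :: "('a, 'b) ring_scheme" (structure) and M :: "('a, 'm) module" (structure) +
  assumes smult_closed:
      "\<lbrakk>a \<in> carrier R; x \<in> carrier M\<rbrakk> \<Longrightarrow> a \<odot>\<^bsub>M\<^esub> x \<in> carrier M"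
    and smult_l_distr:
      "\<lbrakk>a \<in> carrier R; b \<in> carrier R; x \<in> carrier M\<rbrakk> \<Longrightarrow>
       (a \<oplus> b) \<odot>\<^bsub>M\<^esub> x = a \<odot>\<^bsub>M\<^esub> x \<oplus>\<^bsub>M\<^esub> b \<odot>\<^bsub>M\<^esub> x"
    and smult_r_distr:
      "\<lbrakk>a \<in> carrier R; x \<in> carrier M; y \<in> carrier M\<rbrakk> \<Longrightarrow>
       a \<odot>\<^bsub>M\<^esub> (x \<oplus>\<^bsub>M\<^esub> y) = a \<odot>\<^bsub>M\<^esub> x \<oplus>\<^bsub>M\<^esub> a \<odot>\<^bsub>M\<^esub> y"
    and smult_assoc:
      "\<lbrakk>a \<in> carrier R; b \<in> carrier R; x \<in> carrier M\<rbrakk> \<Longrightarrow>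
       (a \<otimes> b) \<odot>\<^bsub>M\<^esub> x = b \<odot>\<^bsub>M\<^esub> (a \<odot>\<^bsub>M\<^esub> x)"
    and smult_one: "x \<in> carrier M \<Longrightarrow> \<one> \<odot>\<^bsub>M\<^esub> x = x"

text \<open>The definitions in terms of \<open>submodule\<close> and of additive maps commuting with \<open>\<odot>\<close> serve
  both sides. The library locale \<open>submodule\<close> does not refer to commutativity.\<close>

definition simple_module :: "('a, 'b) ring_scheme \<Rightarrow> ('a, 'm) module \<Rightarrow> bool" where
  "simple_module R M \<longleftrightarrow>
     carrier M \<noteq> {\<zero>\<^bsub>M\<^esub>} \<and>
     (\<forall>N. submodule N R M \<longrightarrow> N = {\<zero>\<^bsub>M\<^esub>} \<or> N = carrier M)"

definition module_hom ::
  "('a, 'b) ring_scheme \<Rightarrow> ('a, 'm) module \<Rightarrow> ('a, 'n) module \<Rightarrow> ('m \<Rightarrow> 'n) set" where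
  "module_hom R M N =
     {f \<in> hom (add_monoid M) (add_monoid N).
        \<forall>r\<in>carrier R. \<forall>x\<in>carrier M. f (r \<odot>\<^bsub>M\<^esub> x) = r \<odot>\<^bsub>N\<^esub> f x}"


section \<open>Tensor products and flatness\<close>

text \<open>For a right module \<open>A\<close> and a left module \<open>B\<close>, the group \<open>A \<otimes>\<^bsub>R\<^esub> B\<close> is the
  free abelian group on the pairs \<open>(a, b)\<close> modulo the subgroup generated by the usual
  relations. The last set of relations expresses \<open>a r \<otimes> b = a \<otimes> r b\<close>.\<close>

definition tensor_relations ::
  "('a, 'r) ring_scheme \<Rightarrow> ('a, 'm) module \<Rightarrow> ('a, 'n) module \<Rightarrow> ('m \<times> 'n \<Rightarrow>\<^sub>0 int) set" where
  "tensor_relations R A B =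
     {frag_of (a \<oplus>\<^bsub>A\<^esub> a', b) - frag_of (a, b) - frag_of (a', b) | a a' b.
        a \<in> carrier A \<and> a' \<in> carrier A \<and> b \<in> carrier B} \<union>
     {frag_of (a, b \<oplus>\<^bsub>B\<^esub> b') - frag_of (a, b) - frag_of (a, b') | a b b'.
        a \<in> carrier A \<and> b \<in> carrier B \<and> b' \<in> carrier B} \<union>
     {frag_of (r \<odot>\<^bsub>A\<^esub> a, b) - frag_of (a, r \<odot>\<^bsub>B\<^esub> b) | r a b.
        r \<in> carrier R \<and> a \<in> carrier A \<and> b \<in> carrier B}"

definition tensor_kernel ::
  "('a, 'r) ring_scheme \<Rightarrow> ('a, 'm) module \<Rightarrow> ('a, 'n) module \<Rightarrow> ('m \<times> 'n \<Rightarrow>\<^sub>0 int) set" where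
  "tensor_kernel R A B =
     generate (free_Abelian_group (carrier A \<times> carrier B)) (tensor_relations R A B)"

definition tensor_product ::
  "('a, 'r) ring_scheme \<Rightarrow> ('a, 'm) module \<Rightarrow> ('a, 'n) module \<Rightarrow>
    ('m \<times> 'n \<Rightarrow>\<^sub>0 int) set monoid" where
  "tensor_product R A B =
     free_Abelian_group (carrier A \<times> carrier B) Mod tensor_kernel R A B"

text \<open>The map \<open>f \<otimes> g\<close> from \<open>A \<otimes>\<^bsub>R\<^esub> B\<close> to \<open>A' \<otimes>\<^bsub>R\<^esub> B'\<close> induced by
  \<open>(a, b) \<mapsto> (f a, g b)\<close>: the image of a coset under the map of free abelian groups lies in a
  single coset, which is recovered by adding the subgroup of relations.\<close>

definition tensor_map ::
  "('a, 'r) ring_scheme \<Rightarrow> ('a, 'm') module \<Rightarrow> ('a, 'n') module \<Rightarrow>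
    ('m \<Rightarrow> 'm') \<Rightarrow> ('n \<Rightarrow> 'n') \<Rightarrow>
    ('m \<times> 'n \<Rightarrow>\<^sub>0 int) set \<Rightarrow> ('m' \<times> 'n' \<Rightarrow>\<^sub>0 int) set" where
  "tensor_map R A' B' f g C =
     tensor_kernel R A' B' <#>\<^bsub>free_Abelian_group (carrier A' \<times> carrier B')\<^esub>
       (frag_extend (\<lambda>(a, b). frag_of (f a, g b)) ` C)"

text \<open>A module is flat if tensoring with it preserves injectivity of module homomorphisms.
  A definition cannot quantify over the carrier types of the test modules \<open>A\<close> and \<open>B\<close>, so
  these have carriers in the type \<open>(nat \<Rightarrow> 'a) set\<close>. This is no restriction: every finitely
  (even countably) generated module is isomorphic to a quotient of the module of finitely
  supported sequences in the ring, hence to a module whose elements are cosets in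
  \<open>nat \<Rightarrow> 'a\<close>; and if an injective homomorphism between arbitrary modules
  becomes non-injective after tensoring, then so does its restriction to suitable finitely
  generated submodules of source and target, because a single element and finitely many
  relations witness the failure.\<close>

definition flat_left_module :: "('a, 'r) ring_scheme \<Rightarrow> ('a, 'm) module \<Rightarrow> bool" where
  "flat_left_module R M \<longleftrightarrow>
     (\<forall>(A :: ('a, (nat \<Rightarrow> 'a) set) module) (B :: ('a, (nat \<Rightarrow> 'a) set) module) f.
        right_module R A \<longrightarrow> right_module R B \<longrightarrow> f \<in> module_hom R A B \<longrightarrow>
        inj_on f (carrier A) \<longrightarrow>
        inj_on (tensor_map R B M f id) (carrier (tensor_product R A M)))"

definition flat_right_module :: "('a, 'r) ring_scheme \<Rightarrow> ('a, 'm) module \<Rightarrow> bool" where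
  "flat_right_module R M \<longleftrightarrow>
     (\<forall>(A :: ('a, (nat \<Rightarrow> 'a) set) module) (B :: ('a, (nat \<Rightarrow> 'a) set) module) f.
        left_module R A \<longrightarrow> left_module R B \<longrightarrow> f \<in> module_hom R A B \<longrightarrow>
        inj_on f (carrier A) \<longrightarrow>
        inj_on (tensor_map R M B id f) (carrier (tensor_product R M A)))"

text \<open>A simple module is generated by any nonzero element, hence isomorphic to the quotient of
  the ring by a one-sided ideal. Its elements can thus be taken to be cosets, of type
  \<open>'a set\<close>, and the quantifiers below cover all simple modules up to isomorphism.\<close>

definition left_SF_ring :: "('a, 'r) ring_scheme \<Rightarrow> bool" where
  "left_SF_ring R \<longleftrightarrow>
     (\<forall>M :: ('a, 'a set) module.
        left_module R M \<longrightarrow> simple_module R M \<longrightarrow> flat_left_module R M)"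

definition right_SF_ring :: "('a, 'r) ring_scheme \<Rightarrow> bool" where
  "right_SF_ring R \<longleftrightarrow>
     (\<forall>M :: ('a, 'a set) module.
        right_module R M \<longrightarrow> simple_module R M \<longrightarrow> flat_right_module R M)"

end

theory Submission
  imports Defs
begin

text \<open>
  If every maximal left ideal \<open>M\<close> is two-sided, then \<open>R / M\<close> is a division ring. A nilpotent
  product \<open>x y\<close> is then zero in each \<open>R / M\<close>, so each \<open>M\<close> contains \<open>x\<close> or \<open>y\<close>, and with it
  \<open>y R x\<close>. Hence \<open>y R x\<close> lies in the Jacobson radical (\<open>left_quasi_duo_imp_NJ_reflexive\<close>).

  For the converse, flatness of \<open>R / M\<close> gives for each \<open>a\<close> in \<open>M\<close> some \<open>b\<close> in \<open>M\<close> with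
  \<open>a = a b\<close> (\<open>flat_left_quotient_module_imp_fix\<close>). Then \<open>a (1 - b) = 0\<close>. In an NJ-reflexive
  ring, a product \<open>c d = 0\<close> forces \<open>c R d\<close> into the radical: all elements of \<open>d R c\<close> have
  square zero (\<open>NJ_reflexive_zero_product\<close>). So \<open>a r (1 - b)\<close> lies in \<open>M\<close> for each \<open>r\<close>; since
  \<open>a r b\<close> lies in \<open>M\<close> as well, so does \<open>a r\<close>, and \<open>M\<close> is two-sided (\<open>left_quasi_duoI\<close>).

  The statements about the right side are those about the left side for the opposite ring. This
  needs two symmetries: the radical, defined by maximal left ideals, is the same for the opposite
  ring (\<open>jacobson_radical_opposite_ring\<close>), and exchanging the factors of a tensor product turns
  flat right modules into flat left modules over the opposite ring
  (\<open>flat_left_module_opposite_ring\<close>).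
\<close>

section \<open>The opposite ring\<close>

definition opposite_ring :: "('a, 'b) ring_scheme \<Rightarrow> ('a, 'b) ring_scheme" where
  "opposite_ring R = R\<lparr>mult := \<lambda>x y. y \<otimes>\<^bsub>R\<^esub> x\<rparr>"

lemma opposite_ring_simps [simp]:
  "carrier (opposite_ring R) = carrier R"
  "x \<otimes>\<^bsub>opposite_ring R\<^esub> y = y \<otimes>\<^bsub>R\<^esub> x"
  "\<one>\<^bsub>opposite_ring R\<^esub> = \<one>\<^bsub>R\<^esub>"
  "\<zero>\<^bsub>opposite_ring R\<^esub> = \<zero>\<^bsub>R\<^esub>"
  "x \<oplus>\<^bsub>opposite_ring R\<^esub> y = x \<oplus>\<^bsub>R\<^esub> y"
  "add (opposite_ring R) = add R"
  "a_inv (opposite_ring R) = a_inv R"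
  "x \<ominus>\<^bsub>opposite_ring R\<^esub> y = x \<ominus>\<^bsub>R\<^esub> y"
  "opposite_ring (opposite_ring R) = R"
  by (simp_all add: opposite_ring_def a_inv_def a_minus_def)

lemma ring_opposite_ring:
  assumes "ring R"
  shows "ring (opposite_ring R)"
proof -
  interpret ring R by fact
  show ?thesis
    by (rule ringI, rule abelian_groupI)
      (auto simp: a_assoc m_assoc l_distr r_distr intro: a_comm l_neg monoidI)
qed

lemma opposite_ring_nat_pow:
  assumes "ring R" "x \<in> carrier R"
  shows "x [^]\<^bsub>opposite_ring R\<^esub> (n::nat) = x [^]\<^bsub>R\<^esub> n"
proof -
  interpret ring R by fact
  interpret op: ring "opposite_ring R" using assms(1) by (rule ring_opposite_ring)
  show ?thesis
    using assms(2) nat_pow_Suc2 by (induction n) auto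
qed

lemma nilpotents_opposite_ring:
  assumes "ring R"
  shows "nilpotents (opposite_ring R) = nilpotents R"
  using opposite_ring_nat_pow [OF assms] by (auto simp: nilpotents_def)

lemma additive_subgroup_opposite_ring [simp]:
  "additive_subgroup I (opposite_ring R) \<longleftrightarrow> additive_subgroup I R"
proof -
  have "add_monoid (opposite_ring R) = add_monoid R"
    by simp
  then show ?thesis
    by (simp only: additive_subgroup_def)
qed

lemma left_ideal_opposite_ring:
  assumes "ring R"
  shows "left_ideal I (opposite_ring R) \<longleftrightarrow> right_ideal I R"
  using assms ring_opposite_ring [OF assms]
  by (auto simp: left_ideal_def right_ideal_def left_ideal_axioms_def right_ideal_axioms_def)

lemma maximal_left_ideal_opposite_ring:
  assumes "ring R"
  shows "maximal_left_ideal I (opposite_ring R) \<longleftrightarrow> maximal_right_ideal I R"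
  by (simp add: maximal_left_ideal_def maximal_right_ideal_def maximal_left_ideal_axioms_def
      maximal_right_ideal_axioms_def left_ideal_opposite_ring [OF assms])

lemma ideal_iff_left_right_ideal: "ideal I R \<longleftrightarrow> left_ideal I R \<and> right_ideal I R"
  by (auto simp: ideal_def left_ideal_def right_ideal_def ideal_axioms_def
      left_ideal_axioms_def right_ideal_axioms_def)

lemma left_quasi_duo_opposite_ring:
  assumes "ring R"
  shows "left_quasi_duo (opposite_ring R) \<longleftrightarrow> right_quasi_duo R"
proof -
  have "ideal I (opposite_ring R) \<longleftrightarrow> ideal I R" for I
    using left_ideal_opposite_ring [OF assms, of I]
      left_ideal_opposite_ring [OF ring_opposite_ring [OF assms], of I]
    by (auto simp: ideal_iff_left_right_ideal)
  then show ?thesis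
    by (simp add: left_quasi_duo_def right_quasi_duo_def maximal_left_ideal_opposite_ring [OF assms])
qed


section \<open>One-sided ideals and the Jacobson radical\<close>

text \<open>Negatives come for free, because \<open>\<ominus> a = (\<ominus> \<one>) \<otimes> a\<close>.\<close>

lemma (in ring) left_idealI:
  assumes "I \<subseteq> carrier R" "\<zero> \<in> I"
    and add: "\<And>a b. \<lbrakk>a \<in> I; b \<in> I\<rbrakk> \<Longrightarrow> a \<oplus> b \<in> I"
    and mult: "\<And>a x. \<lbrakk>a \<in> I; x \<in> carrier R\<rbrakk> \<Longrightarrow> x \<otimes> a \<in> I"
  shows "left_ideal I R"
proof -
  have "\<ominus> a \<in> I" if "a \<in> I" for a
  proof -
    have "\<ominus> \<one> \<otimes> a \<in> I"
      using that by (intro mult) auto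
    then show ?thesis
      using that assms(1) by (simp add: l_minus subset_iff)
  qed
  then have "subgroup I (add_monoid R)"
    using assms by (intro subgroup.intro) (auto simp: a_inv_def)
  then show ?thesis
    using mult by (intro left_ideal.intro additive_subgroupI left_ideal_axioms.intro ring_axioms)
qed

lemma (in left_ideal) one_imp_carrier:
  assumes "\<one> \<in> I"
  shows "I = carrier R"
  using a_subset left_closed [OF assms] by force

lemma (in left_ideal) left_ideal_sum_principal:
  assumes z: "z \<in> carrier R"
  shows "left_ideal {m \<oplus> r \<otimes> z | m r. m \<in> I \<and> r \<in> carrier R} R" (is "left_ideal ?J R")
proof (rule left_idealI)
  have J: "x \<in> ?J" if "m \<in> I" "r \<in> carrier R" "m \<oplus> r \<otimes> z = x" for m r x
    using that by blast
  show "?J \<subseteq> carrier R"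
    using z by auto
  show "\<zero> \<in> ?J"
    using z by (intro J [of \<zero> \<zero>]) auto
  show "a \<oplus> b \<in> ?J" if ab: "a \<in> ?J" "b \<in> ?J" for a b
  proof -
    obtain m r where a: "m \<in> I" "r \<in> carrier R" "a = m \<oplus> r \<otimes> z"
      using ab(1) by blast
    obtain m' r' where b: "m' \<in> I" "r' \<in> carrier R" "b = m' \<oplus> r' \<otimes> z"
      using ab(2) by blast
    show ?thesis
      using z a b by (intro J [of "m \<oplus> m'" "r \<oplus> r'"]) (simp_all add: l_distr a_ac)
  qed
  show "x \<otimes> a \<in> ?J" if a: "a \<in> ?J" and x: "x \<in> carrier R" for a x
  proof -
    obtain m r where "m \<in> I" "r \<in> carrier R" "a = m \<oplus> r \<otimes> z"
      using a by blast
    then show ?thesis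
      using z x by (intro J [of "x \<otimes> m" "x \<otimes> r"]) (simp_all add: r_distr m_assoc left_closed)
  qed
qed

lemma (in maximal_left_ideal) one_notin: "\<one> \<notin> I"
  using one_imp_carrier proper by blast

text \<open>The form in which maximality is used: modulo a maximal left ideal, every element outside
  it has a left inverse.\<close>

lemma (in maximal_left_ideal) one_sum_principal:
  assumes "z \<in> carrier R" "z \<notin> I"
  obtains m r where "m \<in> I" "r \<in> carrier R" "\<one> = m \<oplus> r \<otimes> z"
proof -
  let ?J = "{m \<oplus> r \<otimes> z | m r. m \<in> I \<and> r \<in> carrier R}"
  have J: "x \<in> ?J" if "m \<in> I" "r \<in> carrier R" "m \<oplus> r \<otimes> z = x" for m r x
    using that by blast
  have "m \<in> ?J" if "m \<in> I" for m
    using that assms(1) by (intro J [of m \<zero>]) auto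
  then have "I \<subseteq> ?J"
    by (rule subsetI)
  moreover have "z \<in> ?J"
    using assms(1) by (intro J [of \<zero> \<one>]) auto
  ultimately have "?J = carrier R"
    using maximal [OF left_ideal_sum_principal [OF assms(1)]] assms(2) by blast
  then have "\<one> \<in> ?J"
    by simp
  then show thesis
    using that by blast
qed

text \<open>Krull's theorem for left ideals, by Zorn's lemma: an ideal is proper exactly if it misses
  \<open>\<one>\<close>, and this property passes to unions of chains.\<close>

lemma (in left_ideal) maximal_left_ideal_exists:
  assumes "\<one> \<notin> I"
  obtains M where "maximal_left_ideal M R" "I \<subseteq> M"
proof -
  define \<A> where "\<A> = {J. left_ideal J R \<and> I \<subseteq> J \<and> \<one> \<notin> J}"
  have "\<exists>M\<in>\<A>. \<forall>K\<in>\<A>. M \<subseteq> K \<longrightarrow> K = M"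
  proof (rule subset_Zorn_nonempty)
    show "\<A> \<noteq> {}"
      unfolding \<A>_def using assms left_ideal_axioms by blast
  next
    fix \<C> assume "\<C> \<noteq> {}" and \<C>: "subset.chain \<A> \<C>"
    then obtain J0 where J0: "J0 \<in> \<C>"
      by blast
    have A: "left_ideal J R" "I \<subseteq> J" "\<one> \<notin> J" if "J \<in> \<C>" for J
      using that \<C> by (auto simp: subset.chain_def \<A>_def)
    have "left_ideal (\<Union>\<C>) R"
    proof (rule left_idealI, goal_cases)
      case 1
      show ?case
        using A(1) by (meson Sup_least additive_subgroup.a_subset left_ideal.axioms(1))
    next
      case 2
      show ?case
        using A(2) [OF J0] J0 additive_subgroup.zero_closed [OF additive_subgroup_axioms] by blast
    next
      case (3 a b)
      then obtain J where "J \<in> \<C>" "a \<in> J" "b \<in> J"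
        using \<C> by (meson UnionE subset.chain_def subsetD subset_chain_def)
      then show ?case
        using A(1) by (meson UnionI additive_subgroup.a_closed left_ideal.axioms(1))
    next
      case (4 a x)
      then show ?case
        using A(1) by (meson UnionE UnionI left_ideal.left_closed)
    qed
    then show "\<Union>\<C> \<in> \<A>"
      unfolding \<A>_def using J0 A(2,3) by auto
  qed
  then obtain M where M: "left_ideal M R" "I \<subseteq> M" "\<one> \<notin> M"
    and max: "\<And>K. \<lbrakk>left_ideal K R; I \<subseteq> K; \<one> \<notin> K; M \<subseteq> K\<rbrakk> \<Longrightarrow> K = M"
    unfolding \<A>_def by auto
  have "maximal_left_ideal M R"
  proof (intro maximal_left_ideal.intro maximal_left_ideal_axioms.intro M(1))
    show "M \<noteq> carrier R"
      using M(3) by auto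
    show "J = M \<or> J = carrier R" if "left_ideal J R" "M \<subseteq> J" for J
      using that M max left_ideal.one_imp_carrier by blast
  qed
  then show thesis
    using M(2) that by blast
qed

text \<open>Otherwise \<open>\<one> \<ominus> r \<otimes> z\<close> generates a proper left ideal; a maximal left ideal above it would
  contain both this element and \<open>r \<otimes> z\<close>, hence \<open>\<one>\<close>. Together with the next lemma this
  characterizes the radical by left invertibility.\<close>

lemma (in ring) one_minus_left_invertible:
  assumes "z \<in> jacobson_radical R" "r \<in> carrier R"
  shows "\<exists>u\<in>carrier R. u \<otimes> (\<one> \<ominus> r \<otimes> z) = \<one>"
proof (rule ccontr)
  assume not_inv: "\<not> ?thesis"
  have z: "z \<in> carrier R"
    using assms by (simp add: jacobson_radical_def)
  let ?w = "\<one> \<ominus> r \<otimes> z"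
  have w: "?w \<in> carrier R"
    using z assms by simp
  let ?I = "{m \<oplus> u \<otimes> ?w | m u. m \<in> {\<zero>} \<and> u \<in> carrier R}"
  have "left_ideal {\<zero>} R"
    by (rule left_idealI) auto
  then have I: "left_ideal ?I R"
    using w by (rule left_ideal.left_ideal_sum_principal)
  have "\<one> \<notin> ?I"
  proof
    assume "\<one> \<in> ?I"
    then obtain u where "u \<in> carrier R" "\<one> = \<zero> \<oplus> u \<otimes> ?w"
      by blast
    then show False
      using not_inv w by (metis l_zero m_closed)
  qed
  then obtain M where M: "maximal_left_ideal M R" "?I \<subseteq> M"
    by (rule left_ideal.maximal_left_ideal_exists [OF I])
  interpret M: maximal_left_ideal M R by fact
  have "?w = \<zero> \<oplus> \<one> \<otimes> ?w"
    using w by simp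
  then have "?w \<in> M"
    using M(2) by blast
  moreover have "r \<otimes> z \<in> M"
    using assms M(1) by (auto simp: jacobson_radical_def intro: M.left_closed)
  ultimately have "?w \<oplus> r \<otimes> z \<in> M"
    by (rule M.a_closed)
  moreover have "?w \<oplus> r \<otimes> z = \<one>"
    using z assms by (simp add: minus_eq a_assoc l_neg)
  ultimately show False
    using M.one_notin by simp
qed

lemma (in ring) jacobson_radicalI:
  assumes "z \<in> carrier R"
    and inv: "\<And>r. r \<in> carrier R \<Longrightarrow> \<exists>u\<in>carrier R. u \<otimes> (\<one> \<ominus> r \<otimes> z) = \<one>"
  shows "z \<in> jacobson_radical R"
proof -
  have "z \<in> M" if "maximal_left_ideal M R" for M
  proof (rule ccontr)
    assume "z \<notin> M"
    interpret M: maximal_left_ideal M R by fact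
    obtain m r where m: "m \<in> M" and r: "r \<in> carrier R" and one: "\<one> = m \<oplus> r \<otimes> z"
      using M.one_sum_principal \<open>z \<in> carrier R\<close> \<open>z \<notin> M\<close> .
    obtain u where u: "u \<in> carrier R" "u \<otimes> (\<one> \<ominus> r \<otimes> z) = \<one>"
      using inv r by blast
    have "m \<oplus> r \<otimes> z \<ominus> r \<otimes> z = m"
      using m r assms(1) by (simp add: minus_eq a_assoc r_neg)
    then have "\<one> \<ominus> r \<otimes> z = m"
      unfolding one .
    then have "\<one> \<in> M"
      using u M.left_closed [OF m u(1)] by simp
    then show False
      using M.one_notin by simp
  qed
  then show ?thesis
    using assms(1) by (simp add: jacobson_radical_def)
qed

text \<open>The step that removes the handedness from the radical. A left inverse \<open>u\<close> of
  \<open>\<one> \<ominus> r \<otimes> z\<close> is again of the form \<open>\<one> \<ominus> s \<otimes> z\<close>, so it has a left inverse as well and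
  is a unit. It is then a two-sided inverse, and \<open>\<one> \<oplus> z \<otimes> u \<otimes> r\<close> inverts
  \<open>\<one> \<ominus> z \<otimes> r\<close> on the right (the familiar passage from \<open>\<one> \<ominus> r \<otimes> z\<close> to \<open>\<one> \<ominus> z \<otimes> r\<close>).\<close>

lemma (in ring) one_minus_right_invertible:
  assumes "z \<in> jacobson_radical R" "r \<in> carrier R"
  shows "\<exists>u\<in>carrier R. (\<one> \<ominus> z \<otimes> r) \<otimes> u = \<one>"
proof -
  have z: "z \<in> carrier R"
    using assms by (simp add: jacobson_radical_def)
  let ?w = "\<one> \<ominus> r \<otimes> z"
  have w: "?w \<in> carrier R"
    using z assms by simp
  obtain u where u: "u \<in> carrier R" "u \<otimes> ?w = \<one>"
    using one_minus_left_invertible [OF assms] by blast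
  have u_eq: "u = \<one> \<ominus> (\<ominus> (u \<otimes> r)) \<otimes> z"
  proof -
    have "u = u \<otimes> ?w \<oplus> u \<otimes> r \<otimes> z"
      using u(1) z assms(2) by (simp add: minus_eq r_distr r_minus m_assoc a_assoc l_neg)
    also have "\<dots> = \<one> \<ominus> (\<ominus> (u \<otimes> r)) \<otimes> z"
      unfolding u(2) using u(1) z assms(2) by algebra
    finally show ?thesis .
  qed
  then obtain v where v: "v \<in> carrier R" "v \<otimes> u = \<one>"
    using one_minus_left_invertible [OF assms(1), of "\<ominus> (u \<otimes> r)"] u(1) assms(2) by auto
  have "v = ?w"
    using u v w by (metis m_assoc l_one r_one)
  then have wu: "?w \<otimes> u = \<one>"
    using v by simp
  have "(\<one> \<ominus> z \<otimes> r) \<otimes> (\<one> \<oplus> z \<otimes> u \<otimes> r) = \<one> \<ominus> z \<otimes> r \<oplus> z \<otimes> (?w \<otimes> u) \<otimes> r"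
    using u(1) z assms(2) by (simp add: minus_eq l_distr r_distr l_minus r_minus m_assoc a_assoc)
  also have "\<dots> = \<one>"
    unfolding wu using z assms(2) by algebra
  finally show ?thesis
    using u(1) z assms(2) by blast
qed

lemma jacobson_radical_opposite_ring:
  assumes "ring R"
  shows "jacobson_radical (opposite_ring R) = jacobson_radical R"
proof -
  have sub: "jacobson_radical S \<subseteq> jacobson_radical (opposite_ring S)"
    if "ring S" for S :: "('a, 'b) ring_scheme"
  proof
    fix z assume z: "z \<in> jacobson_radical S"
    interpret op: ring "opposite_ring S" using that by (rule ring_opposite_ring)
    show "z \<in> jacobson_radical (opposite_ring S)"
    proof (rule op.jacobson_radicalI)
      show "z \<in> carrier (opposite_ring S)"
        using z by (simp add: jacobson_radical_def)
    qed (use ring.one_minus_right_invertible [OF that z] in simp)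
  qed
  show ?thesis
    using sub [OF assms] sub [OF ring_opposite_ring [OF assms]] by auto
qed

text \<open>Passing to the opposite ring exchanges the roles of \<open>x\<close> and \<open>y\<close> in products such as
  \<open>x \<otimes> r \<otimes> y\<close>, and the conclusion refers to the radical, whose symmetry was just shown.\<close>

lemma NJ_reflexive_opposite_ring:
  assumes "ring R" "NJ_reflexive R"
  shows "NJ_reflexive (opposite_ring R)"
proof -
  interpret ring R by fact
  have "{y \<otimes>\<^bsub>R\<^esub> (r \<otimes>\<^bsub>R\<^esub> x) |r. r \<in> carrier R} = {y \<otimes>\<^bsub>R\<^esub> r \<otimes>\<^bsub>R\<^esub> x |r. r \<in> carrier R}"
    if "x \<in> carrier R" "y \<in> carrier R" for x y
    unfolding Setcompr_eq_image using that by (intro image_cong) (simp_all add: m_assoc)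
  then show ?thesis
    using assms(2)
    by (simp add: NJ_reflexive_def nilpotents_opposite_ring [OF assms(1)]
        jacobson_radical_opposite_ring [OF assms(1)])
qed


section \<open>Quasi-duo rings are NJ-reflexive\<close>

text \<open>The quotient by such an ideal is a division ring. In terms of elements: if \<open>a\<close> is not in
  \<open>M\<close>, it has a left inverse \<open>r\<close> modulo \<open>M\<close>, so \<open>b\<close> is congruent to
  \<open>r \<otimes> (a \<otimes> b)\<close>, which lies in \<open>M\<close>.\<close>

lemma maximal_left_ideal_completely_prime:
  assumes "maximal_left_ideal M R" "ideal M R"
    and "a \<in> carrier R" "b \<in> carrier R" "a \<otimes>\<^bsub>R\<^esub> b \<in> M"
  shows "a \<in> M \<or> b \<in> M"
proof (rule disjCI)
  assume "b \<notin> M"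
  interpret maximal_left_ideal M R by fact
  interpret M: ideal M R by fact
  show "a \<in> M"
  proof (rule ccontr)
    assume "a \<notin> M"
    then obtain m r where mr: "m \<in> M" "r \<in> carrier R" "\<one>\<^bsub>R\<^esub> = m \<oplus>\<^bsub>R\<^esub> r \<otimes>\<^bsub>R\<^esub> a"
      by (rule one_sum_principal [OF assms(3)])
    have "b = m \<otimes>\<^bsub>R\<^esub> b \<oplus>\<^bsub>R\<^esub> r \<otimes>\<^bsub>R\<^esub> (a \<otimes>\<^bsub>R\<^esub> b)"
    proof -
      have m: "m \<in> carrier R"
        using mr(1) by simp
      have "b = (m \<oplus>\<^bsub>R\<^esub> r \<otimes>\<^bsub>R\<^esub> a) \<otimes>\<^bsub>R\<^esub> b"
        unfolding mr(3) [symmetric] using assms(4) by simp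
      also have "\<dots> = m \<otimes>\<^bsub>R\<^esub> b \<oplus>\<^bsub>R\<^esub> r \<otimes>\<^bsub>R\<^esub> (a \<otimes>\<^bsub>R\<^esub> b)"
        using m mr(2) assms(3,4) by (simp add: l_distr m_assoc)
      finally show ?thesis .
    qed
    also have "\<dots> \<in> M"
      using M.I_r_closed [OF mr(1) assms(4)] left_closed [OF assms(5) mr(2)]
      by (rule additive_subgroup.a_closed [OF ideal.axioms(1) [OF assms(2)]])
    finally show False
      using \<open>b \<notin> M\<close> by simp
  qed
qed

lemma nilpotents_subset_completely_prime:
  assumes M: "maximal_left_ideal M R" "ideal M R"
  shows "nilpotents R \<subseteq> M"
proof
  interpret maximal_left_ideal M R by fact
  fix x assume "x \<in> nilpotents R"
  then obtain n :: nat where x: "x \<in> carrier R" and n: "x [^]\<^bsub>R\<^esub> n = \<zero>\<^bsub>R\<^esub>"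
    by (auto simp: nilpotents_def)
  have "x [^]\<^bsub>R\<^esub> k \<in> M \<Longrightarrow> x \<in> M" for k :: nat
  proof (induction k)
    case 0
    then show ?case
      using one_notin by simp
  next
    case (Suc k)
    then show ?case
      using maximal_left_ideal_completely_prime [OF M, of "x [^]\<^bsub>R\<^esub> k" x] x by auto
  qed
  from this [of n] show "x \<in> M"
    using n by simp
qed

text \<open>Taking \<open>r = \<one>\<close> in \<open>x \<otimes> r \<otimes> y\<close>, each maximal left ideal contains the nilpotent
  element \<open>x \<otimes> y\<close>, hence \<open>x\<close> or \<open>y\<close>, hence every \<open>y \<otimes> r \<otimes> x\<close>.\<close>

lemma left_quasi_duo_imp_NJ_reflexive:
  assumes "ring R" "left_quasi_duo R"
  shows "NJ_reflexive R"
  unfolding NJ_reflexive_def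
proof (intro ballI impI)
  interpret ring R by fact
  fix x y
  assume x: "x \<in> carrier R" and y: "y \<in> carrier R"
    and nil: "{x \<otimes>\<^bsub>R\<^esub> r \<otimes>\<^bsub>R\<^esub> y |r. r \<in> carrier R} \<subseteq> nilpotents R"
  have "y \<otimes>\<^bsub>R\<^esub> r \<otimes>\<^bsub>R\<^esub> x \<in> M"
    if r: "r \<in> carrier R" and M: "maximal_left_ideal M R" for r M
  proof -
    have ideal: "ideal M R"
      using assms(2) M by (simp add: left_quasi_duo_def)
    interpret M: ideal M R by fact
    have "x \<otimes>\<^bsub>R\<^esub> \<one>\<^bsub>R\<^esub> \<otimes>\<^bsub>R\<^esub> y \<in> M"
      using nil nilpotents_subset_completely_prime [OF M ideal] by blast
    then have "x \<in> M \<or> y \<in> M"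
      using maximal_left_ideal_completely_prime [OF M ideal x y] x by simp
    then show ?thesis
      using x y r by (auto intro: M.I_l_closed M.I_r_closed)
  qed
  then show "{y \<otimes>\<^bsub>R\<^esub> r \<otimes>\<^bsub>R\<^esub> x |r. r \<in> carrier R} \<subseteq> jacobson_radical R"
    using x y by (auto simp: jacobson_radical_def)
qed


section \<open>NJ-reflexivity and annihilators\<close>

text \<open>If \<open>a \<otimes> b\<close> vanishes, every \<open>b \<otimes> s \<otimes> a\<close> squares to zero, so NJ-reflexivity applies to
  the pair \<open>(b, a)\<close>.\<close>

lemma NJ_reflexive_zero_product:
  assumes "ring R" "NJ_reflexive R"
    and "a \<in> carrier R" "b \<in> carrier R" "a \<otimes>\<^bsub>R\<^esub> b = \<zero>\<^bsub>R\<^esub>" "r \<in> carrier R"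
  shows "a \<otimes>\<^bsub>R\<^esub> r \<otimes>\<^bsub>R\<^esub> b \<in> jacobson_radical R"
proof -
  interpret ring R by fact
  have "b \<otimes>\<^bsub>R\<^esub> s \<otimes>\<^bsub>R\<^esub> a \<in> nilpotents R" if s: "s \<in> carrier R" for s
  proof -
    have "(b \<otimes>\<^bsub>R\<^esub> s \<otimes>\<^bsub>R\<^esub> a) [^]\<^bsub>R\<^esub> (2::nat) = b \<otimes>\<^bsub>R\<^esub> s \<otimes>\<^bsub>R\<^esub> (a \<otimes>\<^bsub>R\<^esub> b) \<otimes>\<^bsub>R\<^esub> s \<otimes>\<^bsub>R\<^esub> a"
      using assms(3,4) s by (simp add: numeral_2_eq_2 m_assoc)
    also have "\<dots> = \<zero>\<^bsub>R\<^esub>"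
      using assms(3-5) s by simp
    finally show ?thesis
      using assms(3,4) s by (auto simp: nilpotents_def)
  qed
  then show ?thesis
    using assms(2-4,6) unfolding NJ_reflexive_def by blast
qed

text \<open>From \<open>a = a \<otimes> b\<close> one gets \<open>a \<otimes> (\<one> \<ominus> b) = \<zero>\<close>, so \<open>a \<otimes> r \<otimes> (\<one> \<ominus> b)\<close> lies in the
  radical and therefore in \<open>M\<close>. As \<open>a \<otimes> r \<otimes> b\<close> lies in the left ideal \<open>M\<close> too, so does
  the sum \<open>a \<otimes> r\<close>.\<close>

lemma left_quasi_duoI:
  assumes "ring R" "NJ_reflexive R"
    and fix_right: "\<And>M a. \<lbrakk>maximal_left_ideal M R; a \<in> M\<rbrakk> \<Longrightarrow> \<exists>b\<in>M. a = a \<otimes>\<^bsub>R\<^esub> b"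
  shows "left_quasi_duo R"
  unfolding left_quasi_duo_def
proof (intro allI impI)
  interpret ring R by fact
  fix M assume M: "maximal_left_ideal M R"
  interpret maximal_left_ideal M R by fact
  have "a \<otimes>\<^bsub>R\<^esub> r \<in> M" if a: "a \<in> M" and r: "r \<in> carrier R" for a r
  proof -
    obtain b where b: "b \<in> M" "a = a \<otimes>\<^bsub>R\<^esub> b"
      using fix_right [OF M a] by blast
    have carr: "a \<in> carrier R" "b \<in> carrier R"
      using a b by auto
    have "a \<otimes>\<^bsub>R\<^esub> (\<one>\<^bsub>R\<^esub> \<ominus>\<^bsub>R\<^esub> b) = a \<ominus>\<^bsub>R\<^esub> a \<otimes>\<^bsub>R\<^esub> b"
      using carr by (simp add: minus_eq r_distr r_minus)
    also have "\<dots> = \<zero>\<^bsub>R\<^esub>"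
      unfolding b(2) [symmetric] using carr by algebra
    finally have "a \<otimes>\<^bsub>R\<^esub> r \<otimes>\<^bsub>R\<^esub> (\<one>\<^bsub>R\<^esub> \<ominus>\<^bsub>R\<^esub> b) \<in> jacobson_radical R"
      using NJ_reflexive_zero_product [OF assms(1,2)] carr r by simp
    then have "a \<otimes>\<^bsub>R\<^esub> r \<otimes>\<^bsub>R\<^esub> (\<one>\<^bsub>R\<^esub> \<ominus>\<^bsub>R\<^esub> b) \<in> M"
      using M by (simp add: jacobson_radical_def)
    moreover have "a \<otimes>\<^bsub>R\<^esub> r \<otimes>\<^bsub>R\<^esub> b \<in> M"
      using b(1) carr r by (intro left_closed) auto
    ultimately have "a \<otimes>\<^bsub>R\<^esub> r \<otimes>\<^bsub>R\<^esub> (\<one>\<^bsub>R\<^esub> \<ominus>\<^bsub>R\<^esub> b) \<oplus>\<^bsub>R\<^esub> a \<otimes>\<^bsub>R\<^esub> r \<otimes>\<^bsub>R\<^esub> b \<in> M"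
      by (rule a_closed)
    also have "a \<otimes>\<^bsub>R\<^esub> r \<otimes>\<^bsub>R\<^esub> (\<one>\<^bsub>R\<^esub> \<ominus>\<^bsub>R\<^esub> b) \<oplus>\<^bsub>R\<^esub> a \<otimes>\<^bsub>R\<^esub> r \<otimes>\<^bsub>R\<^esub> b = a \<otimes>\<^bsub>R\<^esub> r"
      using carr r by (simp add: minus_eq r_distr r_minus a_assoc l_neg)
    finally show ?thesis .
  qed
  then show "ideal M R"
    by (intro idealI ring_axioms a_subgroup) (auto intro: left_closed)
qed


section \<open>Tensor products\<close>

lemma left_module_opposite_ring:
  assumes "right_module R M"
  shows "left_module (opposite_ring R) M"
proof -
  interpret right_module R M by fact
  show ?thesis
    by (intro left_module.intro left_module_axioms.intro ring_opposite_ring R.ring_axioms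
        M.abelian_group_axioms)
      (simp_all add: smult_closed smult_l_distr smult_r_distr smult_assoc smult_one)
qed

lemma right_module_opposite_ring:
  assumes "left_module R M"
  shows "right_module (opposite_ring R) M"
proof -
  interpret left_module R M by fact
  show ?thesis
    by (intro right_module.intro right_module_axioms.intro ring_opposite_ring R.ring_axioms
        M.abelian_group_axioms)
      (simp_all add: smult_closed smult_l_distr smult_r_distr smult_assoc smult_one)
qed

lemma free_Abelian_group_diff_closed:
  assumes "x \<in> carrier (free_Abelian_group S)" "y \<in> carrier (free_Abelian_group S)"
  shows "x - y \<in> carrier (free_Abelian_group S)"
  using assms keys_diff [of x y] by auto

lemma tensor_relations_carrier:
  assumes "right_module R A" "left_module R B"
  shows "tensor_relations R A B \<subseteq> carrier (free_Abelian_group (carrier A \<times> carrier B))"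
proof -
  interpret A: right_module R A by fact
  interpret B: left_module R B by fact
  show ?thesis
    by (auto simp: tensor_relations_def A.smult_closed B.smult_closed
        simp del: carrier_free_Abelian_group_iff intro!: free_Abelian_group_diff_closed)
qed

lemma subgroup_tensor_kernel:
  assumes "right_module R A" "left_module R B"
  shows "subgroup (tensor_kernel R A B) (free_Abelian_group (carrier A \<times> carrier B))"
  unfolding tensor_kernel_def
  using tensor_relations_carrier [OF assms] by (intro group.generate_is_subgroup) auto

lemma tensor_kernel_add:
  assumes "right_module R A" "left_module R B"
    and "x \<in> tensor_kernel R A B" "y \<in> tensor_kernel R A B"
  shows "x + y \<in> tensor_kernel R A B"
  using subgroup.m_closed [OF subgroup_tensor_kernel [OF assms(1,2)] assms(3,4)] by simp

lemma tensor_kernel_uminus: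
  assumes "right_module R A" "left_module R B" "x \<in> tensor_kernel R A B"
  shows "- x \<in> tensor_kernel R A B"
proof -
  have "x \<in> carrier (free_Abelian_group (carrier A \<times> carrier B))"
    using subgroup.subset [OF subgroup_tensor_kernel [OF assms(1,2)]] assms(3) by blast
  then show ?thesis
    using subgroup.m_inv_closed [OF subgroup_tensor_kernel [OF assms(1,2)] assms(3)] by simp
qed

text \<open>To control a homomorphism on the subgroup divided out in a tensor product, it suffices to
  look at the defining relations.\<close>

lemma hom_tensor_kernel:
  assumes "right_module R A" "left_module R B"
    and "group G" "h \<in> hom (free_Abelian_group (carrier A \<times> carrier B)) G" "subgroup K G"
    and "\<And>x. x \<in> tensor_relations R A B \<Longrightarrow> h x \<in> K"
    and "x \<in> tensor_kernel R A B"
  shows "h x \<in> K"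
proof -
  interpret h: group_hom "free_Abelian_group (carrier A \<times> carrier B)" G h
    using assms(3,4) by (simp add: group_hom_def group_hom_axioms_def)
  have "h ` tensor_kernel R A B = generate G (h ` tensor_relations R A B)"
    unfolding tensor_kernel_def
    using tensor_relations_carrier [OF assms(1,2)] by (rule h.generate_img [symmetric])
  also have "\<dots> \<subseteq> K"
    using assms(5,6) by (intro h.H.generate_subgroup_incl) auto
  finally show ?thesis
    using assms(7) by blast
qed

text \<open>The part of the universal property that is needed: a balanced biadditive map kills every
  pair whose elementary tensor is zero. It serves to show that an elementary tensor is not
  zero.\<close>

lemma tensor_kernel_balanced_map:
  assumes "right_module R A" "left_module R B" "comm_group G"
    and closed: "\<And>a b. \<lbrakk>a \<in> carrier A; b \<in> carrier B\<rbrakk> \<Longrightarrow> \<beta> (a, b) \<in> carrier G"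
    and add_left: "\<And>a a' b. \<lbrakk>a \<in> carrier A; a' \<in> carrier A; b \<in> carrier B\<rbrakk> \<Longrightarrow>
        \<beta> (a \<oplus>\<^bsub>A\<^esub> a', b) = \<beta> (a, b) \<otimes>\<^bsub>G\<^esub> \<beta> (a', b)"
    and add_right: "\<And>a b b'. \<lbrakk>a \<in> carrier A; b \<in> carrier B; b' \<in> carrier B\<rbrakk> \<Longrightarrow>
        \<beta> (a, b \<oplus>\<^bsub>B\<^esub> b') = \<beta> (a, b) \<otimes>\<^bsub>G\<^esub> \<beta> (a, b')"
    and balanced: "\<And>r a b. \<lbrakk>r \<in> carrier R; a \<in> carrier A; b \<in> carrier B\<rbrakk> \<Longrightarrow>
        \<beta> (r \<odot>\<^bsub>A\<^esub> a, b) = \<beta> (a, r \<odot>\<^bsub>B\<^esub> b)"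
    and "a \<in> carrier A" "b \<in> carrier B" "frag_of (a, b) \<in> tensor_kernel R A B"
  shows "\<beta> (a, b) = \<one>\<^bsub>G\<^esub>"
proof -
  interpret A: right_module R A by fact
  interpret B: left_module R B by fact
  interpret G: comm_group G by fact
  let ?F = "free_Abelian_group (carrier A \<times> carrier B)"
  obtain h where h: "h \<in> hom ?F G"
    and h_of: "\<And>p. p \<in> carrier A \<times> carrier B \<Longrightarrow> h (frag_of p) = \<beta> p"
    using G.free_Abelian_group_universal [of \<beta> "carrier A \<times> carrier B"] closed by blast
  interpret h: group_hom ?F G h
    using h G.group_axioms by (simp add: group_hom_def group_hom_axioms_def)
  have h_diff: "h (x - y) = h x \<otimes>\<^bsub>G\<^esub> inv\<^bsub>G\<^esub> (h y)"
    if "x \<in> carrier ?F" "y \<in> carrier ?F" for x y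
    using that h.hom_mult [of x "- y"] h.hom_inv [of y] by simp
  have triple: "h (frag_of p - frag_of q - frag_of r) = \<one>\<^bsub>G\<^esub>"
    if "p \<in> carrier A \<times> carrier B" "q \<in> carrier A \<times> carrier B" "r \<in> carrier A \<times> carrier B"
      and "\<beta> p = \<beta> q \<otimes>\<^bsub>G\<^esub> \<beta> r" for p q r
  proof -
    have "\<beta> q \<in> carrier G" "\<beta> r \<in> carrier G"
      using that closed by auto
    then show ?thesis
      using that by (simp add: h_diff free_Abelian_group_diff_closed h_of G.m_assoc G.m_comm [of "\<beta> q" "\<beta> r"]
          del: carrier_free_Abelian_group_iff)
  qed
  have "h x = \<one>\<^bsub>G\<^esub>" if "x \<in> tensor_relations R A B" for x
    using that unfolding tensor_relations_def
  proof (elim UnE CollectE exE conjE, goal_cases)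
    case (1 a a' b)
    then show ?case
      using add_left by (simp add: triple)
  next
    case (2 a b b')
    then show ?case
      using add_right by (simp add: triple)
  next
    case (3 r a b)
    then have "h x = \<beta> (a, r \<odot>\<^bsub>B\<^esub> b) \<otimes>\<^bsub>G\<^esub> inv\<^bsub>G\<^esub> \<beta> (a, r \<odot>\<^bsub>B\<^esub> b)"
      using balanced by (simp add: h_diff h_of A.smult_closed B.smult_closed
          del: carrier_free_Abelian_group_iff)
    then show ?case
      using 3 closed B.smult_closed by simp
  qed
  then have "h (frag_of (a, b)) \<in> {\<one>\<^bsub>G\<^esub>}"
    by (intro hom_tensor_kernel [OF assms(1,2) G.group_axioms h G.triv_subgroup _ assms(10)]) simp
  then show ?thesis
    using assms(8,9) h_of by simp
qed

lemma hom_frag_extend: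
  assumes "\<And>p. p \<in> S \<Longrightarrow> g p \<in> T"
  shows "frag_extend (\<lambda>p. frag_of (g p)) \<in> hom (free_Abelian_group S) (free_Abelian_group T)"
proof (rule homI)
  fix x assume "x \<in> carrier (free_Abelian_group S)"
  then have "(\<Union>p\<in>Poly_Mapping.keys x. Poly_Mapping.keys (frag_of (g p))) \<subseteq> T"
    using assms by auto
  then show "frag_extend (\<lambda>p. frag_of (g p)) x \<in> carrier (free_Abelian_group T)"
    using keys_frag_extend [of "\<lambda>p. frag_of (g p)" x] by (simp only: carrier_free_Abelian_group_iff)
qed (simp add: frag_extend_add)

lemma set_mult_subgroup_absorb:
  assumes "group G" "subgroup H G" "S \<subseteq> H" "S \<noteq> {}"
  shows "H <#>\<^bsub>G\<^esub> S = H"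
proof
  interpret group G by fact
  interpret H: subgroup H G by fact
  show "H <#>\<^bsub>G\<^esub> S \<subseteq> H"
    using assms(3) by (auto simp: set_mult_def)
  show "H \<subseteq> H <#>\<^bsub>G\<^esub> S"
  proof
    fix h assume h: "h \<in> H"
    obtain s where s: "s \<in> S" "s \<in> H"
      using assms(3,4) by blast
    have "(h \<otimes>\<^bsub>G\<^esub> inv\<^bsub>G\<^esub> s) \<otimes>\<^bsub>G\<^esub> s \<in> H <#>\<^bsub>G\<^esub> S"
      using h s by (auto simp: set_mult_def)
    then show "h \<in> H <#>\<^bsub>G\<^esub> S"
      using h s by (simp add: m_assoc H.mem_carrier)
  qed
qed

lemma module_homD:
  assumes "f \<in> module_hom R A B"
  shows "a \<in> carrier A \<Longrightarrow> f a \<in> carrier B"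
    and "\<lbrakk>a \<in> carrier A; a' \<in> carrier A\<rbrakk> \<Longrightarrow> f (a \<oplus>\<^bsub>A\<^esub> a') = f a \<oplus>\<^bsub>B\<^esub> f a'"
    and "\<lbrakk>r \<in> carrier R; a \<in> carrier A\<rbrakk> \<Longrightarrow> f (r \<odot>\<^bsub>A\<^esub> a) = r \<odot>\<^bsub>B\<^esub> f a"
  using assms by (auto simp: module_hom_def hom_def)

text \<open>If \<open>f a \<otimes> m = 0\<close> and \<open>f \<otimes> id\<close> is injective, then \<open>a \<otimes> m = 0\<close>; membership in
  \<open>tensor_kernel\<close> expresses that an elementary tensor vanishes.\<close>

lemma tensor_map_inj_imp_zero:
  assumes "right_module R A" "right_module R B" "left_module R M" "f \<in> module_hom R A B"
    and inj: "inj_on (tensor_map R B M f id) (carrier (tensor_product R A M))"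
    and "a \<in> carrier A" "m \<in> carrier M" "frag_of (f a, m) \<in> tensor_kernel R B M"
  shows "frag_of (a, m) \<in> tensor_kernel R A M"
proof -
  let ?F = "free_Abelian_group (carrier A \<times> carrier M)"
  let ?F' = "free_Abelian_group (carrier B \<times> carrier M)"
  let ?K = "tensor_kernel R A M"
  let ?K' = "tensor_kernel R B M"
  let ?\<phi> = "frag_extend (\<lambda>(a, b). frag_of (f a, id b))"
  note sub = subgroup_tensor_kernel [OF assms(1,3)]
  note sub' = subgroup_tensor_kernel [OF assms(2,3)]
  interpret F: group ?F by simp
  interpret F': group ?F' by simp
  have K_sub: "?K \<subseteq> carrier ?F"
    using sub by (rule subgroup.subset)
  have zero: "0 \<in> ?K"
    using subgroup.one_closed [OF sub] by simp
  note hom = module_homD [OF assms(4)]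
  have hom_\<phi>: "?\<phi> \<in> hom ?F ?F'"
    using hom_frag_extend [of "carrier A \<times> carrier M" "\<lambda>(a, b). (f a, id b)"
        "carrier B \<times> carrier M"] hom(1) by (simp add: case_prod_unfold mem_Times_iff)
  have "?\<phi> x \<in> ?K'" if "x \<in> tensor_relations R A M" for x
  proof -
    have "?\<phi> x \<in> tensor_relations R B M"
      using that unfolding tensor_relations_def
    proof (elim UnE CollectE exE conjE, goal_cases)
      case (1 a a' b)
      then show ?case
        by (intro UnI1 CollectI exI [of _ "f a"] exI [of _ "f a'"] exI [of _ b])
          (simp add: frag_extend_diff hom)
    next
      case (2 a b b')
      then show ?case
        by (intro UnI1 [OF UnI2] CollectI exI [of _ "f a"] exI [of _ b] exI [of _ b'])
          (simp add: frag_extend_diff hom)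
    next
      case (3 r a b)
      then show ?case
        by (intro UnI2 CollectI exI [of _ r] exI [of _ "f a"] exI [of _ b])
          (simp add: frag_extend_diff hom)
    qed
    then show ?thesis
      by (simp add: tensor_kernel_def generate.incl)
  qed
  then have \<phi>_K: "?\<phi> x \<in> ?K'" if "x \<in> ?K" for x
    by (rule hom_tensor_kernel [OF assms(1,3) F'.group_axioms hom_\<phi> sub' _ that])
  \<comment> \<open>The coset of \<open>x\<close> and the zero coset both go to the zero coset.\<close>
  have trivial: "tensor_map R B M f id (?K #>\<^bsub>?F\<^esub> x) = ?K'"
    if "x \<in> carrier ?F" "?\<phi> x \<in> ?K'" for x
    unfolding tensor_map_def
  proof (rule set_mult_subgroup_absorb [OF F'.group_axioms sub'])
    show "?\<phi> ` (?K #>\<^bsub>?F\<^esub> x) \<subseteq> ?K'"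
      using tensor_kernel_add [OF assms(2,3) \<phi>_K that(2)]
      by (auto simp: r_coset_def frag_extend_add)
    show "?\<phi> ` (?K #>\<^bsub>?F\<^esub> x) \<noteq> {}"
      using zero by (auto simp: r_coset_def)
  qed
  let ?x = "frag_of (a, m)"
  have x: "?x \<in> carrier ?F"
    using assms(6,7) by simp
  have "?K #>\<^bsub>?F\<^esub> ?x = ?K #>\<^bsub>?F\<^esub> 0"
  proof (rule inj_onD [OF inj])
    show "tensor_map R B M f id (?K #>\<^bsub>?F\<^esub> ?x) = tensor_map R B M f id (?K #>\<^bsub>?F\<^esub> 0)"
      using x assms(8) \<phi>_K [OF zero] by (simp add: trivial)
    show "?K #>\<^bsub>?F\<^esub> ?x \<in> carrier (tensor_product R A M)"
      unfolding tensor_product_def FactGroup_def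
      using F.rcosetsI [OF K_sub x] by simp
    show "?K #>\<^bsub>?F\<^esub> 0 \<in> carrier (tensor_product R A M)"
      unfolding tensor_product_def FactGroup_def
      using F.rcosetsI [OF K_sub F.one_closed] by simp
  qed
  moreover have "?x \<in> ?K #>\<^bsub>?F\<^esub> ?x"
    using F.rcos_self [OF x sub] .
  ultimately have "?x \<in> ?K #>\<^bsub>?F\<^esub> 0"
    by simp
  then show ?thesis
    by (simp add: r_coset_def)
qed


section \<open>Exchanging the factors of a tensor product\<close>

text \<open>On free abelian groups, the map \<open>a \<otimes> b \<mapsto> b \<otimes> a\<close> that identifies \<open>A \<otimes> B\<close> over a
  ring with \<open>B \<otimes> A\<close> over the opposite ring. It reduces flatness of right modules to
  flatness of left modules.\<close>

definition frag_swap :: "('a \<times> 'b \<Rightarrow>\<^sub>0 int) \<Rightarrow> ('b \<times> 'a \<Rightarrow>\<^sub>0 int)" where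
  "frag_swap = frag_extend (frag_of \<circ> prod.swap)"

lemma frag_swap_of [simp]: "frag_swap (frag_of (a, b)) = frag_of (b, a)"
  by (simp add: frag_swap_def)

lemma frag_swap_add: "frag_swap (x + y) = frag_swap x + frag_swap y"
  by (simp add: frag_swap_def frag_extend_add)

lemma frag_swap_diff: "frag_swap (x - y) = frag_swap x - frag_swap y"
  by (simp add: frag_swap_def frag_extend_diff)

lemma frag_swap_swap [simp]: "frag_swap (frag_swap x) = x"
proof -
  have "frag_swap (frag_swap x) = frag_extend (frag_of \<circ> (prod.swap \<circ> prod.swap)) x"
    unfolding frag_swap_def frag_extend_compose by (simp add: comp_assoc)
  then show ?thesis
    using frag_expansion [of x] by simp
qed

lemma inj_frag_swap: "inj frag_swap"
  by (rule inj_on_inverseI) (rule frag_swap_swap)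

lemma hom_frag_swap:
  "frag_swap \<in> hom (free_Abelian_group (S \<times> T)) (free_Abelian_group (T \<times> S))"
  unfolding frag_swap_def comp_def by (rule hom_frag_extend) auto

lemma frag_swap_tensor_kernel_subset:
  assumes "right_module R A" "left_module R B"
  shows "frag_swap ` tensor_kernel R A B \<subseteq> tensor_kernel (opposite_ring R) B A"
proof safe
  note op = right_module_opposite_ring [OF assms(2)] left_module_opposite_ring [OF assms(1)]
  fix x assume x: "x \<in> tensor_kernel R A B"
  show "frag_swap x \<in> tensor_kernel (opposite_ring R) B A"
  proof (rule hom_tensor_kernel [OF assms _ hom_frag_swap subgroup_tensor_kernel [OF op] _ x])
    fix x assume "x \<in> tensor_relations R A B"
    \<comment> \<open>The relation \<open>a r \<otimes> b = a \<otimes> r b\<close> comes back with the opposite sign.\<close>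
    then have "frag_swap x \<in> tensor_relations (opposite_ring R) B A \<or>
        - frag_swap x \<in> tensor_relations (opposite_ring R) B A"
      unfolding tensor_relations_def
    proof (elim UnE CollectE exE conjE, goal_cases)
      case (1 a a' b)
      then show ?case
        by (intro disjI1 UnI1 [OF UnI2] CollectI exI [of _ b] exI [of _ a] exI [of _ a'])
          (simp add: frag_swap_diff)
    next
      case (2 a b b')
      then show ?case
        by (intro disjI1 UnI1 CollectI exI [of _ b] exI [of _ b'] exI [of _ a])
          (simp add: frag_swap_diff)
    next
      case (3 r a b)
      then show ?case
        by (intro disjI2 UnI2 CollectI exI [of _ r] exI [of _ b] exI [of _ a])
          (simp add: frag_swap_diff)
    qed
    then have "frag_swap x \<in> tensor_kernel (opposite_ring R) B A \<or>
        - frag_swap x \<in> tensor_kernel (opposite_ring R) B A"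
      unfolding tensor_kernel_def by (blast intro: generate.incl)
    then show "frag_swap x \<in> tensor_kernel (opposite_ring R) B A"
      using tensor_kernel_uminus [OF op, of "- frag_swap x"] by auto
  qed simp
qed

lemma frag_swap_tensor_kernel:
  assumes "right_module R A" "left_module R B"
  shows "frag_swap ` tensor_kernel R A B = tensor_kernel (opposite_ring R) B A"
proof
  show "frag_swap ` tensor_kernel R A B \<subseteq> tensor_kernel (opposite_ring R) B A"
    using assms by (rule frag_swap_tensor_kernel_subset)
  have "frag_swap ` tensor_kernel (opposite_ring R) B A \<subseteq> tensor_kernel R A B"
    using frag_swap_tensor_kernel_subset [OF right_module_opposite_ring [OF assms(2)]
        left_module_opposite_ring [OF assms(1)]] by simp
  then show "tensor_kernel (opposite_ring R) B A \<subseteq> frag_swap ` tensor_kernel R A B"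
    by (metis (no_types, lifting) frag_swap_swap image_eqI image_subset_iff subsetI)
qed

lemma frag_swap_tensor_product:
  assumes "right_module R A" "left_module R B" "C \<in> carrier (tensor_product R A B)"
  shows "frag_swap ` C \<in> carrier (tensor_product (opposite_ring R) B A)"
proof -
  let ?F = "free_Abelian_group (carrier A \<times> carrier B)"
  let ?F' = "free_Abelian_group (carrier B \<times> carrier A)"
  obtain x where x: "x \<in> carrier ?F" and C: "C = tensor_kernel R A B #>\<^bsub>?F\<^esub> x"
    using assms(3) by (auto simp: tensor_product_def FactGroup_def RCOSETS_def)
  have "frag_swap ` C = tensor_kernel (opposite_ring R) B A #>\<^bsub>?F'\<^esub> frag_swap x"
    unfolding C frag_swap_tensor_kernel [OF assms(1,2), symmetric]
    by (simp add: r_coset_def image_UN frag_swap_add)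
  moreover have "frag_swap x \<in> carrier ?F'"
    using hom_frag_swap x by (auto simp: hom_def simp del: carrier_free_Abelian_group_iff)
  ultimately show ?thesis
    unfolding tensor_product_def FactGroup_def RCOSETS_def by auto
qed

lemma frag_swap_tensor_map:
  assumes "right_module R A'" "left_module R B'"
  shows "frag_swap ` tensor_map R A' B' f g C =
    tensor_map (opposite_ring R) B' A' g f (frag_swap ` C)"
proof -
  have "frag_swap (frag_extend (\<lambda>(a, b). frag_of (f a, g b)) x) =
      frag_extend (\<lambda>(b, a). frag_of (g b, f a)) (frag_swap x)" for x
  proof -
    have "frag_swap (frag_extend (frag_of \<circ> map_prod f g) x) =
        frag_extend (frag_of \<circ> map_prod g f) (frag_swap x)"
      unfolding frag_swap_def frag_extend_compose
      by (rule frag_extend_eq) (simp add: prod.swap_def map_prod_def case_prod_unfold)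
    then show ?thesis
      by (simp add: comp_def map_prod_def case_prod_unfold)
  qed
  then show ?thesis
    unfolding tensor_map_def frag_swap_tensor_kernel [OF assms, symmetric]
    by (simp add: set_mult_def image_UN frag_swap_add)
qed

lemma flat_left_module_opposite_ring:
  fixes R :: "('a, 'b) ring_scheme" and M :: "('a, 'm) module"
  assumes "right_module R M" "flat_right_module R M"
  shows "flat_left_module (opposite_ring R) M"
  unfolding flat_left_module_def
proof (intro allI impI)
  fix A B :: "('a, (nat \<Rightarrow> 'a) set) module" and f
  let ?S = "opposite_ring R"
  assume A: "right_module ?S A" and B: "right_module ?S B"
    and f: "f \<in> module_hom ?S A B" "inj_on f (carrier A)"
  have "left_module R A" "left_module R B"
    using left_module_opposite_ring [OF A] left_module_opposite_ring [OF B] by simp_all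
  moreover have "f \<in> module_hom R A B"
    using f(1) by (simp add: module_hom_def)
  ultimately have inj: "inj_on (tensor_map R M B id f) (carrier (tensor_product R M A))"
    using assms(2) f(2) by (simp add: flat_right_module_def)
  have M: "left_module ?S M"
    using assms(1) by (rule left_module_opposite_ring)
  show "inj_on (tensor_map ?S B M f id) (carrier (tensor_product ?S A M))"
  proof (rule inj_onI)
    fix C D
    assume C: "C \<in> carrier (tensor_product ?S A M)" and D: "D \<in> carrier (tensor_product ?S A M)"
      and "tensor_map ?S B M f id C = tensor_map ?S B M f id D"
    then have "tensor_map R M B id f (frag_swap ` C) = tensor_map R M B id f (frag_swap ` D)"
      using frag_swap_tensor_map [OF B M, of f id] by (metis opposite_ring_simps(9))
    then have "frag_swap ` C = frag_swap ` D"
    proof (rule inj_onD [OF inj])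
      show "frag_swap ` C \<in> carrier (tensor_product R M A)"
        using frag_swap_tensor_product [OF A M C] by simp
      show "frag_swap ` D \<in> carrier (tensor_product R M A)"
        using frag_swap_tensor_product [OF A M D] by simp
    qed
    then show "C = D"
      by (simp only: inj_image_eq_iff [OF inj_frag_swap])
  qed
qed

lemma left_SF_ring_opposite_ring:
  fixes R :: "('a, 'b) ring_scheme"
  assumes "right_SF_ring R"
  shows "left_SF_ring (opposite_ring R)"
  unfolding left_SF_ring_def
proof (intro allI impI)
  fix M :: "('a, 'a set) module"
  assume "left_module (opposite_ring R) M" and simple: "simple_module (opposite_ring R) M"
  then have M: "right_module R M"
    using right_module_opposite_ring by force
  moreover have "simple_module R M"
    using simple by (simp add: simple_module_def submodule_def submodule_axioms_def)
  ultimately have "flat_right_module R M"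
    using assms by (simp add: right_SF_ring_def)
  then show "flat_left_module (opposite_ring R) M"
    using M by (intro flat_left_module_opposite_ring)
qed


section \<open>Flat quotients by left ideals\<close>

text \<open>The left module \<open>R / I\<close>. The union over all representatives \<open>x\<close> of the coset is
  again a single coset, so no representative has to be chosen.\<close>

definition left_quotient_module :: "('a, 'b) ring_scheme \<Rightarrow> 'a set \<Rightarrow> ('a, 'a set) module" where
  "left_quotient_module R I = \<lparr>carrier = a_rcosets\<^bsub>R\<^esub> I, monoid.mult = undefined, one = undefined,
     ring.zero = I, ring.add = set_add R, module.smult = \<lambda>r C. \<Union>x\<in>C. I +>\<^bsub>R\<^esub> (r \<otimes>\<^bsub>R\<^esub> x)\<rparr>"

lemma mem_a_r_coset_iff: "y \<in> H +>\<^bsub>G\<^esub> x \<longleftrightarrow> (\<exists>h\<in>H. y = h \<oplus>\<^bsub>G\<^esub> x)"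
  by (auto simp: a_r_coset_def r_coset_def)

lemma (in left_ideal) abelian_subgroup: "abelian_subgroup I R"
  by (rule abelian_subgroupI3 [OF additive_subgroup_axioms abelian_group_axioms])

lemma (in left_ideal) left_quotient_module_carrier:
  "carrier (left_quotient_module R I) = (\<lambda>x. I +> x) ` carrier R"
  by (auto simp: left_quotient_module_def A_RCOSETS_def')

lemma (in left_ideal) coset_zero: "I +> \<zero> = I"
  using a_subset by (rule a_coset_add_zero)

lemma (in left_ideal) coset_smult:
  assumes "r \<in> carrier R" "x \<in> carrier R"
  shows "r \<odot>\<^bsub>left_quotient_module R I\<^esub> (I +> x) = I +> (r \<otimes> x)"
proof -
  interpret abelian_subgroup I R by (rule abelian_subgroup)
  have "I +> (r \<otimes> y) = I +> (r \<otimes> x)" if y: "y \<in> I +> x" for y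
  proof -
    obtain i where i: "i \<in> I" "y = i \<oplus> x"
      using y unfolding mem_a_r_coset_iff by blast
    have "r \<otimes> y = r \<otimes> i \<oplus> r \<otimes> x"
      using i assms by (simp add: r_distr)
    then have "r \<otimes> y \<in> I +> (r \<otimes> x)"
      using left_closed [OF i(1) assms(1)] unfolding mem_a_r_coset_iff by (rule bexI)
    then show ?thesis
      using assms by (intro a_repr_independence' [symmetric]) auto
  qed
  then have "(\<Union>y\<in>I +> x. I +> (r \<otimes> y)) = (\<Union>y\<in>I +> x. I +> (r \<otimes> x))"
    by (rule SUP_cong [OF refl])
  moreover have "I +> x \<noteq> {}"
    using a_rcos_self [OF assms(2)] by blast
  ultimately show ?thesis
    by (simp only: left_quotient_module_def module.select_convs UN_constant if_False)
qed

lemma (in left_ideal) coset_add: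
  assumes "x \<in> carrier R" "y \<in> carrier R"
  shows "(I +> x) \<oplus>\<^bsub>left_quotient_module R I\<^esub> (I +> y) = I +> (x \<oplus> y)"
  using abelian_subgroup.a_rcos_sum [OF abelian_subgroup assms]
  by (simp add: left_quotient_module_def)

lemma (in left_ideal) zero_left_quotient_module: "\<zero>\<^bsub>left_quotient_module R I\<^esub> = I +> \<zero>"
  by (simp add: left_quotient_module_def coset_zero)

lemma (in left_ideal) left_module_left_quotient_module:
  "left_module R (left_quotient_module R I)"
proof -
  let ?Q = "left_quotient_module R I"
  note simps = left_quotient_module_carrier coset_add coset_smult zero_left_quotient_module
  have "abelian_group ?Q"
  proof (rule abelian_groupI)
    fix C assume "C \<in> carrier ?Q"
    then obtain x where "x \<in> carrier R" "C = I +> x"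
      by (auto simp: simps)
    then show "\<exists>D\<in>carrier ?Q. D \<oplus>\<^bsub>?Q\<^esub> C = \<zero>\<^bsub>?Q\<^esub>"
      by (intro bexI [of _ "I +> (\<ominus> x)"]) (simp_all add: simps l_neg)
  qed (auto simp: simps a_ac)
  then show ?thesis
    by (intro left_module.intro left_module_axioms.intro ring_axioms)
      (auto simp: simps l_distr r_distr m_assoc)
qed

text \<open>The preimage of a submodule of \<open>R / I\<close> is a left ideal above \<open>I\<close>, hence \<open>I\<close> or the
  whole ring.\<close>

lemma (in maximal_left_ideal) simple_left_quotient_module:
  "simple_module R (left_quotient_module R I)"
proof -
  let ?Q = "left_quotient_module R I"
  have "N = {\<zero>\<^bsub>?Q\<^esub>} \<or> N = carrier ?Q" if "submodule N R ?Q" for N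
  proof -
    interpret N: submodule N R ?Q by fact
    have N_add: "C \<oplus>\<^bsub>?Q\<^esub> D \<in> N" if "C \<in> N" "D \<in> N" for C D
      using N.m_closed that by simp
    have N_zero: "I +> \<zero> \<in> N"
      using N.one_closed by (simp add: zero_left_quotient_module)
    have N_sub: "N \<subseteq> carrier ?Q"
      using N.subset by simp
    define J where "J = {x \<in> carrier R. I +> x \<in> N}"
    have "left_ideal J R"
    proof (rule left_idealI)
      show "a \<oplus> b \<in> J" if "a \<in> J" "b \<in> J" for a b
        using that N_add [of "I +> a" "I +> b"] by (simp add: J_def coset_add)
      show "x \<otimes> a \<in> J" if "a \<in> J" "x \<in> carrier R" for a x
        using that N.smult_closed [of x "I +> a"] by (simp add: J_def coset_smult)
    qed (use N_zero in \<open>auto simp: J_def\<close>)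
    moreover have "I \<subseteq> J"
    proof
      fix x assume x: "x \<in> I"
      have "I +> x = I +> \<zero>"
        unfolding coset_zero by (rule abelian_subgroup.a_rcos_const [OF abelian_subgroup x])
      then show "x \<in> J"
        using x N_zero by (simp add: J_def)
    qed
    ultimately consider "J = I" | "J = carrier R"
      using maximal by blast
    then show ?thesis
    proof cases
      case 1
      have "C = \<zero>\<^bsub>?Q\<^esub>" if C: "C \<in> N" for C
      proof -
        obtain x where x: "x \<in> carrier R" "C = I +> x"
          using C N_sub left_quotient_module_carrier by blast
        then have "x \<in> J"
          using C by (simp add: J_def)
        then have "I +> x = I"
          unfolding \<open>J = I\<close> by (rule abelian_subgroup.a_rcos_const [OF abelian_subgroup])
        then show ?thesis
          using x(2) by (simp add: zero_left_quotient_module coset_zero)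
      qed
      then have "N = {\<zero>\<^bsub>?Q\<^esub>}"
        using N_zero unfolding zero_left_quotient_module by blast
      then show ?thesis
        by (rule disjI1)
    next
      case 2
      then have "I +> x \<in> N" if "x \<in> carrier R" for x
        using that unfolding J_def by blast
      then have "carrier ?Q \<subseteq> N"
        unfolding left_quotient_module_carrier by (rule image_subsetI)
      then show ?thesis
        using N_sub by blast
    qed
  qed
  moreover have "carrier ?Q \<noteq> {\<zero>\<^bsub>?Q\<^esub>}"
  proof
    assume trivial: "carrier ?Q = {\<zero>\<^bsub>?Q\<^esub>}"
    have "I +> \<one> \<in> carrier ?Q"
      unfolding left_quotient_module_carrier by simp
    then have "I +> \<one> = I"
      unfolding trivial by (simp add: zero_left_quotient_module coset_zero)
    then show False
      using abelian_subgroup.a_rcos_self [OF abelian_subgroup one_closed] one_notin by simp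
  qed
  ultimately show ?thesis
    by (simp add: simple_module_def)
qed

text \<open>Flatness is tested on modules whose elements are sets of sequences. A ring element \<open>x\<close> is
  represented there by the singleton of the constant sequence \<open>x\<close>, so that right ideals can
  be test modules; \<open>elem_const\<close> decodes.\<close>

definition const_elem :: "'a \<Rightarrow> (nat \<Rightarrow> 'a) set" where
  "const_elem x = {\<lambda>_. x}"

definition elem_const :: "(nat \<Rightarrow> 'a) set \<Rightarrow> 'a" where
  "elem_const C = the_elem C 0"

lemma elem_const_const_elem [simp]: "elem_const (const_elem x) = x"
  by (simp add: const_elem_def elem_const_def)

definition right_ideal_module ::
  "('a, 'b) ring_scheme \<Rightarrow> 'a set \<Rightarrow> ('a, (nat \<Rightarrow> 'a) set) module" where
  "right_ideal_module R J = \<lparr>carrier = const_elem ` J, monoid.mult = undefined, one = undefined,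
     ring.zero = const_elem \<zero>\<^bsub>R\<^esub>, ring.add = \<lambda>C D. const_elem (elem_const C \<oplus>\<^bsub>R\<^esub> elem_const D),
     module.smult = \<lambda>r C. const_elem (elem_const C \<otimes>\<^bsub>R\<^esub> r)\<rparr>"

lemma right_ideal_module_simps [simp]:
  "carrier (right_ideal_module R J) = const_elem ` J"
  "\<zero>\<^bsub>right_ideal_module R J\<^esub> = const_elem \<zero>\<^bsub>R\<^esub>"
  "C \<oplus>\<^bsub>right_ideal_module R J\<^esub> D = const_elem (elem_const C \<oplus>\<^bsub>R\<^esub> elem_const D)"
  "r \<odot>\<^bsub>right_ideal_module R J\<^esub> C = const_elem (elem_const C \<otimes>\<^bsub>R\<^esub> r)"
  by (simp_all add: right_ideal_module_def)

lemma (in right_ideal) right_module_right_ideal_module: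
  "right_module R (right_ideal_module R I)"
proof -
  let ?M = "right_ideal_module R I"
  have "abelian_group ?M"
  proof (rule abelian_groupI)
    fix C assume "C \<in> carrier ?M"
    then obtain x where "x \<in> I" "C = const_elem x"
      by auto
    then show "\<exists>D\<in>carrier ?M. D \<oplus>\<^bsub>?M\<^esub> C = \<zero>\<^bsub>?M\<^esub>"
      by (intro bexI [of _ "const_elem (\<ominus> x)"]) (simp_all add: l_neg)
  qed (auto simp: a_assoc intro!: arg_cong [where f = const_elem] a_comm)
  then show ?thesis
    by (intro right_module.intro right_module_axioms.intro ring_axioms)
      (auto simp: l_distr r_distr m_assoc right_closed)
qed

lemma (in ring) right_ideal_principal:
  assumes "a \<in> carrier R"
  shows "right_ideal ((\<lambda>r. a \<otimes> r) ` carrier R) R"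
proof -
  interpret op: ring "opposite_ring R" by (rule ring_opposite_ring) (rule ring_axioms)
  have "left_ideal ((\<lambda>r. a \<otimes> r) ` carrier R) (opposite_ring R)"
  proof (rule op.left_idealI)
    show "\<zero>\<^bsub>opposite_ring R\<^esub> \<in> (\<lambda>r. a \<otimes> r) ` carrier R"
      using assms by (auto intro!: image_eqI [of _ _ \<zero>])
    fix b c assume "b \<in> (\<lambda>r. a \<otimes> r) ` carrier R" "c \<in> (\<lambda>r. a \<otimes> r) ` carrier R"
    then obtain r s where "r \<in> carrier R" "s \<in> carrier R" "b = a \<otimes> r" "c = a \<otimes> s"
      by blast
    then show "b \<oplus>\<^bsub>opposite_ring R\<^esub> c \<in> (\<lambda>r. a \<otimes> r) ` carrier R"
      using assms by (intro image_eqI [of _ _ "r \<oplus> s"]) (simp_all add: r_distr)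
  next
    fix b x assume "b \<in> (\<lambda>r. a \<otimes> r) ` carrier R" "x \<in> carrier (opposite_ring R)"
    then obtain r where "r \<in> carrier R" "b = a \<otimes> r" "x \<in> carrier R"
      by auto
    then show "x \<otimes>\<^bsub>opposite_ring R\<^esub> b \<in> (\<lambda>r. a \<otimes> r) ` carrier R"
      using assms by (intro image_eqI [of _ _ "r \<otimes> x"]) (simp_all add: m_assoc)
  qed (use assms in auto)
  then show ?thesis
    using left_ideal_opposite_ring [OF ring_axioms] by simp
qed

text \<open>The set \<open>a I\<close> is in general no ideal on either side, but it is the subgroup modulo which the
  values of the balanced map in the next lemma are taken.\<close>

lemma (in left_ideal) additive_subgroup_left_translate:
  assumes "a \<in> carrier R"
  shows "additive_subgroup ((\<lambda>i. a \<otimes> i) ` I) R"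
proof (intro additive_subgroupI subgroup.intro)
  fix x y assume "x \<in> (\<lambda>i. a \<otimes> i) ` I" "y \<in> (\<lambda>i. a \<otimes> i) ` I"
  then obtain i j where "i \<in> I" "j \<in> I" "x = a \<otimes> i" "y = a \<otimes> j"
    by blast
  then show "x \<otimes>\<^bsub>add_monoid R\<^esub> y \<in> (\<lambda>i. a \<otimes> i) ` I"
    using assms by (intro image_eqI [of _ _ "i \<oplus> j"]) (simp_all add: r_distr)
next
  fix x assume "x \<in> (\<lambda>i. a \<otimes> i) ` I"
  then obtain i where "i \<in> I" "x = a \<otimes> i"
    by blast
  then show "inv\<^bsub>add_monoid R\<^esub> x \<in> (\<lambda>i. a \<otimes> i) ` I"
    using assms by (intro image_eqI [of _ _ "\<ominus> i"]) (simp_all add: r_minus flip: a_inv_def)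
qed (use assms in \<open>auto intro!: image_eqI [of _ _ \<zero>]\<close>)

text \<open>Compare the inclusion of \<open>a R\<close> in \<open>R\<close> after tensoring with \<open>R / I\<close>. In
  \<open>R \<otimes> R / I\<close>, the tensor \<open>a \<otimes> 1\<close> equals \<open>1 \<otimes> a\<close>, which is zero because \<open>a\<close> lies
  in \<open>I\<close>. By flatness \<open>a \<otimes> 1\<close> is already zero in \<open>a R \<otimes> R / I\<close>. The product
  \<open>(x, d + I) \<mapsto> x d + a I\<close> is well defined and balanced for \<open>x\<close> in \<open>a R\<close>, because
  \<open>a r I\<close> is contained in \<open>a I\<close>; it sends \<open>(a, 1 + I)\<close> to \<open>a + a I\<close>, so \<open>a\<close> lies in
  \<open>a I\<close>.\<close>

lemma (in left_ideal) flat_left_quotient_module_imp_fix: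
  assumes flat: "flat_left_module R (left_quotient_module R I)" and a: "a \<in> I"
  shows "\<exists>b\<in>I. a = a \<otimes> b"
proof -
  let ?Q = "left_quotient_module R I"
  let ?J = "(\<lambda>r. a \<otimes> r) ` carrier R"
  let ?A = "right_ideal_module R ?J"
  let ?B = "right_ideal_module R (carrier R)"
  have a_carr: "a \<in> carrier R"
    using a by simp
  have Q: "left_module R ?Q"
    by (rule left_module_left_quotient_module)
  have J: "right_ideal ?J R"
    using a_carr by (rule right_ideal_principal)
  then have A: "right_module R ?A"
    by (rule right_ideal.right_module_right_ideal_module)
  have "right_ideal (carrier R) R"
    using right_ideal_principal [OF one_closed] by simp
  then have B: "right_module R ?B"
    by (rule right_ideal.right_module_right_ideal_module)
  have incl: "(\<lambda>C. C) \<in> module_hom R ?A ?B"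
    using a_carr by (auto simp: module_hom_def hom_def)
  have a_J: "a \<in> ?J"
    using a_carr by (intro image_eqI [of _ _ \<one>]) auto
  have one_Q: "I +> \<one> \<in> carrier ?Q" and zero_Q: "I +> \<zero> \<in> carrier ?Q"
    by (auto simp: left_quotient_module_carrier)
  let ?K = "tensor_kernel R ?B ?Q"
  have rel: "x \<in> ?K" if "x \<in> tensor_relations R ?B ?Q" for x
    using that by (simp add: tensor_kernel_def generate.incl)
  \<comment> \<open>\<open>a \<otimes> 1 = 1 \<otimes> a\<close>, and the coset of \<open>a\<close> is the zero coset.\<close>
  have "frag_of (const_elem a, I +> \<one>) - frag_of (const_elem \<one>, I +> \<zero>) \<in> ?K"
  proof (rule rel)
    have "a \<odot>\<^bsub>?B\<^esub> const_elem \<one> = const_elem a"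
      using a_carr by simp
    moreover have "a \<odot>\<^bsub>?Q\<^esub> (I +> \<one>) = I +> \<zero>"
      using a a_carr abelian_subgroup.a_rcos_const [OF abelian_subgroup a] coset_smult coset_zero
      by simp
    ultimately show "frag_of (const_elem a, I +> \<one>) - frag_of (const_elem \<one>, I +> \<zero>)
        \<in> tensor_relations R ?B ?Q"
      unfolding tensor_relations_def using a_carr one_Q
      by (intro UnI2 CollectI exI [of _ a] exI [of _ "const_elem \<one>"] exI [of _ "I +> \<one>"]) auto
  qed
  moreover have "frag_of (const_elem \<one>, I +> \<zero>) \<in> ?K"
  proof -
    let ?z = "frag_of (const_elem \<one>, I +> \<zero>)"
    \<comment> \<open>\<open>1 \<otimes> (0 + 0) = 1 \<otimes> 0 + 1 \<otimes> 0\<close>\<close>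
    have "?z - ?z - ?z \<in> ?K"
    proof (rule rel)
      have "(I +> \<zero>) \<oplus>\<^bsub>?Q\<^esub> (I +> \<zero>) = I +> \<zero>"
        using coset_add [OF zero_closed zero_closed] by simp
      then show "?z - ?z - ?z \<in> tensor_relations R ?B ?Q"
        unfolding tensor_relations_def using zero_Q
        by (intro UnI1 [OF UnI2] CollectI exI [of _ "const_elem \<one>"] exI [of _ "I +> \<zero>"]) auto
    qed
    then show ?thesis
      using tensor_kernel_uminus [OF B Q] by fastforce
  qed
  ultimately have "frag_of (const_elem a, I +> \<one>) \<in> ?K"
    using tensor_kernel_add [OF B Q] by fastforce
  moreover have "inj_on (tensor_map R ?B ?Q (\<lambda>C. C) id) (carrier (tensor_product R ?A ?Q))"
    using flat A B incl by (simp add: flat_left_module_def)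
  ultimately have kernel: "frag_of (const_elem a, I +> \<one>) \<in> tensor_kernel R ?A ?Q"
    using a_J one_Q by (intro tensor_map_inj_imp_zero [OF A B Q incl]) auto
  let ?N = "(\<lambda>i. a \<otimes> i) ` I"
  have N_sub: "additive_subgroup ?N R"
    using a_carr by (rule additive_subgroup_left_translate)
  interpret N: abelian_subgroup ?N R
    by (rule abelian_subgroupI3 [OF N_sub abelian_group_axioms])
  have G: "comm_group (R A_Mod ?N)"
    by (rule N.a_factorgroup_is_comm_group)
  define \<beta> where "\<beta> = (\<lambda>(C, D). \<Union>d\<in>D. ?N +> (elem_const C \<otimes> d))"
  have \<beta>: "\<beta> (const_elem x, I +> d) = ?N +> (x \<otimes> d)" if x: "x \<in> ?J" and d: "d \<in> carrier R" for x d
  proof -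
    obtain r where r: "r \<in> carrier R" "x = a \<otimes> r"
      using x by blast
    have "?N +> (x \<otimes> e) = ?N +> (x \<otimes> d)" if e: "e \<in> I +> d" for e
    proof -
      obtain i where i: "i \<in> I" "e = i \<oplus> d"
        using e unfolding mem_a_r_coset_iff by blast
      have "x \<otimes> e = a \<otimes> (r \<otimes> i) \<oplus> x \<otimes> d"
        using i r d a_carr by (simp add: r_distr m_assoc)
      moreover have "a \<otimes> (r \<otimes> i) \<in> ?N"
        using left_closed [OF i(1) r(1)] by blast
      ultimately have "x \<otimes> e \<in> ?N +> (x \<otimes> d)"
        unfolding mem_a_r_coset_iff by (rule bexI)
      then show ?thesis
        using r d a_carr by (intro N.a_repr_independence' [symmetric]) auto
    qed
    then have "(\<Union>e\<in>I +> d. ?N +> (x \<otimes> e)) = (\<Union>e\<in>I +> d. ?N +> (x \<otimes> d))"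
      by (rule SUP_cong [OF refl])
    moreover have "I +> d \<noteq> {}"
      using abelian_subgroup.a_rcos_self [OF abelian_subgroup d] by blast
    ultimately show ?thesis
      by (simp only: \<beta>_def case_prod_conv elem_const_const_elem UN_constant if_False)
  qed
  have J_carr: "x \<in> carrier R" if "x \<in> ?J" for x
    using that a_carr by blast
  have mult_G: "(?N +> x) \<otimes>\<^bsub>R A_Mod ?N\<^esub> (?N +> y) = ?N +> (x \<oplus> y)"
    if "x \<in> carrier R" "y \<in> carrier R" for x y
    using N.a_rcos_sum that by simp
  have cosets_G: "?N +> x \<in> carrier (R A_Mod ?N)" if "x \<in> carrier R" for x
    unfolding A_FactGroup_def' partial_object.select_convs
    using N.a_subset that by (rule a_rcosetsI)
  have "\<beta> (const_elem a, I +> \<one>) = \<one>\<^bsub>R A_Mod ?N\<^esub>"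
  proof (rule tensor_kernel_balanced_map [OF A Q G _ _ _ _ _ one_Q kernel])
    fix C D assume "C \<in> carrier ?A" and "D \<in> carrier ?Q"
    then obtain x d where x: "x \<in> ?J" "C = const_elem x" and d: "d \<in> carrier R" "D = I +> d"
      by (auto simp: left_quotient_module_carrier)
    note xR = J_carr [OF x(1)]
    show "\<beta> (C, D) \<in> carrier (R A_Mod ?N)"
      unfolding x(2) d(2) \<beta> [OF x(1) d(1)] using xR d(1) by (intro cosets_G m_closed)
    fix C' assume "C' \<in> carrier ?A"
    then obtain x' where x': "x' \<in> ?J" "C' = const_elem x'"
      by auto
    note x'R = J_carr [OF x'(1)]
    have "x \<oplus> x' \<in> ?J"
      using right_ideal.axioms(1) [OF J] x(1) x'(1) by (rule additive_subgroup.a_closed)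
    note \<beta> [OF this d(1)]
    then show "\<beta> (C \<oplus>\<^bsub>?A\<^esub> C', D) = \<beta> (C, D) \<otimes>\<^bsub>R A_Mod ?N\<^esub> \<beta> (C', D)"
      by (simp only: x(2) x'(2) d(2) right_ideal_module_simps elem_const_const_elem
          \<beta> [OF x(1) d(1)] \<beta> [OF x'(1) d(1)] mult_G m_closed xR x'R d(1) l_distr)
  next
    fix C D D' assume "C \<in> carrier ?A" and "D \<in> carrier ?Q" and "D' \<in> carrier ?Q"
    then obtain x d d' where x: "x \<in> ?J" "C = const_elem x" and d: "d \<in> carrier R" "D = I +> d"
      and d': "d' \<in> carrier R" "D' = I +> d'"
      by (auto simp: left_quotient_module_carrier)
    note xR = J_carr [OF x(1)]
    show "\<beta> (C, D \<oplus>\<^bsub>?Q\<^esub> D') = \<beta> (C, D) \<otimes>\<^bsub>R A_Mod ?N\<^esub> \<beta> (C, D')"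
      unfolding x(2) d(2) d'(2) coset_add [OF d(1) d'(1)] \<beta> [OF x(1) d(1)] \<beta> [OF x(1) d'(1)]
        \<beta> [OF x(1) a_closed [OF d(1) d'(1)]] r_distr [OF d(1) d'(1) xR]
      using xR d(1) d'(1) by (intro mult_G [symmetric] m_closed)
  next
    fix r C D assume r: "r \<in> carrier R" and "C \<in> carrier ?A" and "D \<in> carrier ?Q"
    then obtain x d where x: "x \<in> ?J" "C = const_elem x" and d: "d \<in> carrier R" "D = I +> d"
      by (auto simp: left_quotient_module_carrier)
    note xR = J_carr [OF x(1)]
    have "x \<otimes> r \<in> ?J"
      using J x(1) r by (rule right_ideal.right_closed)
    note \<beta> [OF this d(1)]
    then show "\<beta> (r \<odot>\<^bsub>?A\<^esub> C, D) = \<beta> (C, r \<odot>\<^bsub>?Q\<^esub> D)"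
      by (simp only: x(2) d(2) right_ideal_module_simps elem_const_const_elem
          coset_smult [OF r d(1)] \<beta> [OF x(1) m_closed [OF r d(1)]] m_assoc [OF xR r d(1)])
  next
    show "const_elem a \<in> carrier ?A"
      unfolding right_ideal_module_simps using a_J by (rule imageI)
  qed
  then have "?N +> a = ?N"
    unfolding \<beta> [OF a_J one_closed] r_one [OF a_carr] by (simp add: A_FactGroup_def')
  then have "a \<in> ?N"
    using N.a_rcos_self [OF a_carr] by (simp only:)
  then show ?thesis
    by blast
qed

section \<open>Quasi-duo rings, SF-rings and NJ-reflexivity\<close>

theorem theorem2p9:
  fixes R :: "('a, 'b) ring_scheme"
  assumes "ring R"
  shows "(left_quasi_duo R \<longrightarrow> NJ_reflexive R) \<and>
         (right_quasi_duo R \<longrightarrow> NJ_reflexive R) \<and>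
         (left_SF_ring R \<and> NJ_reflexive R \<longrightarrow> left_quasi_duo R) \<and>
         (right_SF_ring R \<and> NJ_reflexive R \<longrightarrow> right_quasi_duo R)"
proof (intro conjI impI; (elim conjE)?)
  let ?S = "opposite_ring R"
  have S: "ring ?S"
    using assms by (rule ring_opposite_ring)
  have SF: "left_quasi_duo T" if "ring T" "left_SF_ring T" "NJ_reflexive T"
    for T :: "('a, 'b) ring_scheme"
  proof (rule left_quasi_duoI [OF that(1,3)])
    fix M a assume M: "maximal_left_ideal M T" and a: "a \<in> M"
    interpret maximal_left_ideal M T by fact
    show "\<exists>b\<in>M. a = a \<otimes>\<^bsub>T\<^esub> b"
      using that(2) left_module_left_quotient_module simple_left_quotient_module a
      by (intro flat_left_quotient_module_imp_fix) (simp_all add: left_SF_ring_def)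
  qed
  show "NJ_reflexive R" if "left_quasi_duo R"
    using assms that by (rule left_quasi_duo_imp_NJ_reflexive)
  show "NJ_reflexive R" if "right_quasi_duo R"
  proof -
    have "NJ_reflexive ?S"
      using that left_quasi_duo_opposite_ring [OF assms]
      by (intro left_quasi_duo_imp_NJ_reflexive [OF S]) simp
    then show ?thesis
      using NJ_reflexive_opposite_ring [OF S] by simp
  qed
  show "left_quasi_duo R" if "left_SF_ring R" "NJ_reflexive R"
    using assms that by (rule SF)
  show "right_quasi_duo R" if "right_SF_ring R" "NJ_reflexive R"
  proof -
    have "left_quasi_duo ?S"
      using S left_SF_ring_opposite_ring [OF that(1)] NJ_reflexive_opposite_ring [OF assms that(2)]
      by (rule SF)
    then show ?thesis
      using left_quasi_duo_opposite_ring [OF assms] by simp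
  qed
qed

end
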